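(* There exists a constant $C > 0$, independent of $f$, such that the following holds. Let $f = \{f(k)\}_{k=1}^\infty$ be a real sequence such that the Hamburger moment problem for $f$ is solvable, and assume that there exists an essentially bounded periodic function $g(t)$ on $\mathbb R$ such that $$f(k) = \frac{1}{2\pi}\int_0^{2\pi} g(t)e^{-ikt}\,dt, \quad k \in \mathbb N.$$ Let $M = \mathrm{ess\,sup}_{t\in\mathbb R}|g(t)|$. Then for all $\varepsilon \in (0,1)$ and all $d \in \mathbb N$ there exists a tensor $T$ of size $2\times\dots\times 2 = 2^d$ ($d$ factors) with tensor train ranks not exceeding $$C\, d\,\bigl(\ln(d) + \ln(1/\varepsilon) + \ln(M) + 1\bigr)$$ such that $\|Q(d,f) - T\|_F \le \varepsilon$.
   Context: Here $\mathbb N = \{1,2,3,\dots\}$ and $\|\cdot\|_F$ is the Frobenius norm (square root of the sum of squared absolute values of all entries). The function $g$ may be complex-valued. Hamburger moment problem: it is said to be solvable for a real sequence $f$ if there exists a positive Borel measure $\mu$ on $\mathbb R$ such that $f(k) = \int_{\mathbb R} t^{k-1}\,d\mu(t)$ for all $k\in\mathbb N$. The tensor $Q(d,f)$: the $d$-dimensional tensor of size $2\times\dots\times 2$ obtained by natural reshaping of the vector $(f(1),\dots,f(2^d))$; that is, with indices $i_1,\dots,i_d\in\{0,1\}$, $Q(d,f)(i_1,\dots,i_d) = f\bigl(1+\sum_{s=1}^d i_s 2^{d-s}\bigr)$. Equivalently, its $s$-unfolding matrix (merging the first $s$ indices into a row index and the last $d-s$ into a column index) is the $2^s\times 2^{d-s}$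 matrix with entries $f((i-1)2^{d-s}+j)$. Tensor train ranks: a tensor train decomposition of a $d$-dimensional tensor $A$ is a representation $$A(i_1,\dots,i_d) = \sum_{\alpha_1=1}^{R_1}\cdots\sum_{\alpha_{d-1}=1}^{R_{d-1}} G_1(i_1,\alpha_1)G_2(\alpha_1,i_2,\alpha_2)\cdots G_{d-1}(\alpha_{d-2},i_{d-1},\alpha_{d-1})G_d(\alpha_{d-1},i_d).$$ The tensor train ranks of $A$ are the minimal possible $R_1,\dots,R_{d-1}$; the minimal $R_s$ equals the rank of the $s$-unfolding matrix of $A$, $s=1,\dots,d-1$.
   Formalization: The rank bound is replaced by the maximum of 0 and C d (ln d + ln(1/ε) + ln M + 1), and by 0 when M = 0, since the original bound is negative for small M (undefined for M = 0) and then no tensor with d ≥ 2 can satisfy it. *)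

theory Defs
  imports "HOL-Probability.Essential_Supremum"
begin

text \<open>
  A \<open>d\<close>-dimensional tensor of size \<open>2 \<times> \<dots> \<times> 2\<close> is a function on index lists
  \<open>[i\<^sub>1, \<dots>, i\<^sub>d]\<close>; only its values on \<open>tensor_index d\<close> are relevant.
\<close>

definition tensor_index :: "nat \<Rightarrow> nat list set" where
  "tensor_index d = {is. length is = d \<and> set is \<subseteq> {0, 1}}"

definition frobenius_norm :: "nat \<Rightarrow> (nat list \<Rightarrow> 'a::real_normed_vector) \<Rightarrow> real" where
  "frobenius_norm d A = sqrt (\<Sum>is\<in>tensor_index d. (norm (A is))\<^sup>2)"

text \<open>Sequences are indexed from 1: the value \<open>f 0\<close> is never used.\<close>

definition Q :: "nat \<Rightarrow> (nat \<Rightarrow> 'a) \<Rightarrow> nat list \<Rightarrow> 'a" where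
  "Q d f is = f (1 + (\<Sum>s=1..d. is ! (s - 1) * 2 ^ (d - s)))"

text \<open>
  The cores \<open>G\<^sub>1(i\<^sub>1, \<alpha>\<^sub>1)\<close> and \<open>G\<^sub>d(\<alpha>\<^sub>d\<^sub>-\<^sub>1, i\<^sub>d)\<close> are given the shape of the inner ones by the
  dummy indices \<open>\<alpha>\<^sub>0 = \<alpha>\<^sub>d = 1\<close>, that is, \<open>R\<^sub>0 = R\<^sub>d = 1\<close>. For \<open>1 \<le> s < d\<close> the value
  \<open>R\<^sub>s = 0\<close> is allowed; the sum is then empty, and the tensor is zero.
\<close>

definition tt_decomposition ::
    "nat \<Rightarrow> (nat \<Rightarrow> nat) \<Rightarrow> (nat \<Rightarrow> nat \<Rightarrow> nat \<Rightarrow> nat \<Rightarrow> 'a::comm_ring_1) \<Rightarrow> (nat list \<Rightarrow> 'a) \<Rightarrow> bool"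
  where
  "tt_decomposition d R G A \<longleftrightarrow>
     R 0 = 1 \<and> R d = 1 \<and>
     (\<forall>is\<in>tensor_index d.
        A is = (\<Sum>\<alpha>\<in>(\<Pi>\<^sub>E s\<in>{0..d}. {1..R s}). \<Prod>s=1..d. G s (\<alpha> (s - 1)) (is ! (s - 1)) (\<alpha> s)))"

text \<open>
  The minimal possible \<open>R\<^sub>s\<close>, for \<open>1 \<le> s < d\<close>. Every tensor has a tensor train decomposition,
  so the minimum exists; it is the rank of the \<open>s\<close>-unfolding matrix, and for all \<open>s\<close> it is attained
  by one and the same decomposition.
\<close>

definition tt_rank :: "nat \<Rightarrow> (nat list \<Rightarrow> 'a::comm_ring_1) \<Rightarrow> nat \<Rightarrow> nat" where
  "tt_rank d A s = (LEAST r. \<exists>R G. tt_decomposition d R G A \<and> R s = r)"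

definition hamburger_solvable :: "(nat \<Rightarrow> real) \<Rightarrow> bool" where
  "hamburger_solvable f \<longleftrightarrow>
     (\<exists>\<mu>::real measure. sets \<mu> = sets borel \<and>
        (\<forall>k\<ge>1. integrable \<mu> (\<lambda>t. t ^ (k - 1)) \<and> f k = (LINT t|\<mu>. t ^ (k - 1))))"

definition ess_sup_norm :: "(real \<Rightarrow> complex) \<Rightarrow> ereal" where
  "ess_sup_norm g = esssup lebesgue (\<lambda>t. ereal (norm (g t)))"

definition essentially_bounded :: "(real \<Rightarrow> complex) \<Rightarrow> bool" where
  "essentially_bounded g \<longleftrightarrow> g \<in> borel_measurable lebesgue \<and> ess_sup_norm g < \<infinity>"

definition fourier_coeff :: "(real \<Rightarrow> complex) \<Rightarrow> nat \<Rightarrow> complex" where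
  "fourier_coeff g k =
     1 / (2 * of_real pi) *
     (LINT t:{0..2 * pi}|lebesgue. g t * exp (- (\<i> * of_nat k * of_real t)))"

end

theory Submission
  imports Defs
begin

text \<open>
  Let \<open>\<mu>\<close> be the measure, so that \<open>f (n + 1) = \<integral> t\<^sup>n d\<mu>\<close>. Bessel's inequality gives \<open>\<Sum> f(k)\<^sup>2 \<le> M\<^sup>2\<close>, so
  the zero tensor does when \<open>M \<le> \<epsilon>\<close>. The same bound shows that \<open>\<mu>\<close> lives on \<open>(-1, 1)\<close> and that
  \<open>\<mu> {\<bar>t\<bar> \<ge> 1 - h}\<close> is at most \<open>2 M h\<^sup>1\<^sup>/\<^sup>2\<close>. Cut \<open>(-1, 1)\<close> into \<open>2 (d + 1)\<close> blocks, dyadic towards \<open>\<plusminus>1\<close>, and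
  on each block replace \<open>t\<^sup>n\<close> by its Taylor polynomial of degree below \<open>m\<close> at the midpoint. The mass
  bound compensates the slow decay in \<open>n\<close> of the Taylor remainder near \<open>\<plusminus>1\<close>, and every block contributes
  an \<open>l\<^sup>2\<close> error of at most \<open>4 M / 2\<^sup>m\<close>, which makes \<open>m\<close> logarithmic in \<open>d M / \<epsilon>\<close>. The approximant is a
  combination of \<open>2 (d + 1) m\<close> functions \<open>n \<mapsto> (n choose l) z\<^sup>n\<^sup>-\<^sup>l\<close> whose span is closed under shifts; the
  matrices of the shifts form the cores of a tensor train, hence this number bounds all ranks.
\<close>

section \<open>Tensor trains from shift-invariant function families\<close>

text \<open>The sum over index paths is a product of the matrices \<open>H s\<close> applied to the
  vector \<open>u n\<close>. Splitting off the last index of a path absorbs \<open>H (Suc n)\<close>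
  into \<open>u (Suc n)\<close> and leaves the shorter product applied to
  \<open>u n\<close>.\<close>

lemma sum_paths_transfer:
  fixes H :: "nat \<Rightarrow> nat \<Rightarrow> nat \<Rightarrow> 'a::comm_ring_1" and S :: "nat \<Rightarrow> nat set"
  assumes step: "\<And>s \<alpha>. s < n \<Longrightarrow> \<alpha> \<in> S s \<Longrightarrow> u s \<alpha> = (\<Sum>\<beta>\<in>S (Suc s). H (Suc s) \<alpha> \<beta> * u (Suc s) \<beta>)"
  shows "(\<Sum>\<alpha>\<in>(\<Pi>\<^sub>E s\<in>{0..n}. S s). (\<Prod>s=1..n. H s (\<alpha> (s - 1)) (\<alpha> s)) * u n (\<alpha> n)) = (\<Sum>\<alpha>\<in>S 0. u 0 \<alpha>)"
  using step
proof (induction n)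
  case 0
  have eq: "(\<Pi>\<^sub>E s\<in>{0..0}. S s) = (\<lambda>x. (\<lambda>i. undefined)(0 := x)) ` S 0"
    using PiE_insert_eq[of 0 "{}" S] by (auto simp: image_iff)
  have "inj_on (\<lambda>x. (\<lambda>i::nat. undefined)(0 := x)) (S 0)"
    by (metis (no_types, lifting) inj_onI fun_upd_same)
  then show ?case
    unfolding eq by (subst sum.reindex) auto
next
  case (Suc n)
  have split: "{0..Suc n} = insert (Suc n) {0..n}" by auto
  have eq: "(\<Pi>\<^sub>E s\<in>{0..Suc n}. S s) = (\<lambda>(x, \<alpha>). \<alpha>(Suc n := x)) ` (S (Suc n) \<times> (\<Pi>\<^sub>E s\<in>{0..n}. S s))"
    unfolding split PiE_insert_eq by (auto simp: image_iff)
  have inj: "inj_on (\<lambda>(x, \<alpha>). \<alpha>(Suc n := x)) (S (Suc n) \<times> (\<Pi>\<^sub>E s\<in>{0..n}. S s))"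
    using inj_combinator[of "Suc n" "{0..n}" S] by simp
  have "(\<Sum>\<alpha>\<in>(\<Pi>\<^sub>E s\<in>{0..Suc n}. S s). (\<Prod>s=1..Suc n. H s (\<alpha> (s - 1)) (\<alpha> s)) * u (Suc n) (\<alpha> (Suc n)))
      = (\<Sum>(x, \<alpha>)\<in>S (Suc n) \<times> (\<Pi>\<^sub>E s\<in>{0..n}. S s).
          (\<Prod>s=1..n. H s (\<alpha> (s - 1)) (\<alpha> s)) * (H (Suc n) (\<alpha> n) x * u (Suc n) x))"
    unfolding eq
    by (subst sum.reindex[OF inj], rule sum.cong[OF refl], clarsimp simp: prod.nat_ivl_Suc' ac_simps,
        intro arg_cong2[of _ _ _ _ "(*)"] refl prod.cong) auto
  also have "\<dots> = (\<Sum>\<alpha>\<in>(\<Pi>\<^sub>E s\<in>{0..n}. S s). \<Sum>x\<in>S (Suc n).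
          (\<Prod>s=1..n. H s (\<alpha> (s - 1)) (\<alpha> s)) * (H (Suc n) (\<alpha> n) x * u (Suc n) x))"
    by (subst sum.swap) (simp add: sum.cartesian_product)
  also have "\<dots> = (\<Sum>\<alpha>\<in>(\<Pi>\<^sub>E s\<in>{0..n}. S s). (\<Prod>s=1..n. H s (\<alpha> (s - 1)) (\<alpha> s)) * u n (\<alpha> n))"
  proof (rule sum.cong[OF refl])
    fix \<alpha> assume "\<alpha> \<in> (\<Pi>\<^sub>E s\<in>{0..n}. S s)"
    then have "\<alpha> n \<in> S n" by (auto simp: PiE_iff)
    from Suc.prems[OF _ this]
    show "(\<Sum>x\<in>S (Suc n). (\<Prod>s=1..n. H s (\<alpha> (s - 1)) (\<alpha> s)) * (H (Suc n) (\<alpha> n) x * u (Suc n) x))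
        = (\<Prod>s=1..n. H s (\<alpha> (s - 1)) (\<alpha> s)) * u n (\<alpha> n)"
      by (simp add: sum_distrib_left)
  qed
  also have "\<dots> = (\<Sum>\<alpha>\<in>S 0. u 0 \<alpha>)"
    by (rule Suc.IH) (use Suc.prems in auto)
  finally show ?case .
qed

definition index_value :: "nat \<Rightarrow> nat list \<Rightarrow> nat" where
  "index_value d is = (\<Sum>s=1..d. is ! (s - 1) * 2 ^ (d - s))"

lemma index_value_Cons:
  "index_value (Suc d) (b # is) = b * 2 ^ d + index_value d is"
proof -
  have "index_value (Suc d) (b # is) = b * 2 ^ d + (\<Sum>s=Suc 1..Suc d. (b # is) ! (s - 1) * 2 ^ (Suc d - s))"
    unfolding index_value_def by (subst sum.atLeast_Suc_atMost) auto
  also have "(\<Sum>s=Suc 1..Suc d. (b # is) ! (s - 1) * 2 ^ (Suc d - s)) = index_value d is"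
    unfolding index_value_def by (subst sum.shift_bounds_cl_Suc_ivl) (auto intro!: sum.cong simp: nth_Cons')
  finally show ?thesis .
qed

text \<open>Binary expansion is a bijection onto \<open>{..<2 ^ d}\<close>. The induction avoids
  stating it: the leading bit separates the two halves of the range.\<close>

lemma sum_tensor_index:
  fixes h :: "nat \<Rightarrow> 'a::comm_monoid_add"
  shows "(\<Sum>is\<in>tensor_index d. h (index_value d is)) = (\<Sum>n<2 ^ d. h n)"
proof (induction d arbitrary: h)
  case 0
  have "tensor_index 0 = {[]}" by (auto simp: tensor_index_def)
  then show ?case by (simp add: index_value_def)
next
  case (Suc d)
  have eq: "tensor_index (Suc d) = (#) 0 ` tensor_index d \<union> (#) 1 ` tensor_index d"
    by (auto simp: tensor_index_def length_Suc_conv image_iff)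
  have fin: "finite (tensor_index d)"
    using finite_lists_length_eq[of "{0, 1::nat}" d] by (simp add: tensor_index_def conj_commute)
  have "(\<Sum>is\<in>tensor_index (Suc d). h (index_value (Suc d) is))
      = (\<Sum>is\<in>tensor_index d. h (index_value d is)) + (\<Sum>is\<in>tensor_index d. h (2 ^ d + index_value d is))"
    unfolding eq using fin
    by (subst sum.union_disjoint) (auto simp: sum.reindex index_value_Cons)
  also have "\<dots> = (\<Sum>n<2 ^ d. h n) + (\<Sum>n<2 ^ d. h (2 ^ d + n))"
    using Suc.IH[of h] Suc.IH[of "\<lambda>n. h (2 ^ d + n)"] by simp
  also have "\<dots> = (\<Sum>n<2 ^ Suc d. h n)"
    using sum.nat_group[of h "2 ^ d" 2] by (simp add: numeral_2_eq_2 lessThan_Suc ac_simps flip: atLeast0LessThan sum.shift_bounds_nat_ivl)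
  finally show ?case .
qed

text \<open>The functions \<open>\<phi>\<close> span a space closed under shifts; the matrices of the shifts are the inner cores.\<close>

lemma tt_rank_le_shift_invariant:
  fixes \<phi> :: "'b \<Rightarrow> nat \<Rightarrow> 'a::comm_ring_1"
  assumes I: "finite I"
    and shift: "\<And>a n k. a \<in> I \<Longrightarrow> \<phi> a (k + n) = (\<Sum>b\<in>I. A k a b * \<phi> b n)"
    and F: "\<And>n. F n = (\<Sum>a\<in>I. c a * \<phi> a n)"
    and s: "1 \<le> s" "s < d"
  shows "tt_rank d (\<lambda>is. F (index_value d is)) s \<le> card I"
proof -
  obtain e where e: "bij_betw e {1..card I} I"
    using I ex_bij_betw_nat_finite_1 by blast
  have e_in: "e \<alpha> \<in> I" if "\<alpha> \<in> {1..card I}" for \<alpha>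
    using e that by (auto simp: bij_betw_def)
  have sum_e: "(\<Sum>b\<in>I. h b) = (\<Sum>\<beta>=1..card I. h (e \<beta>))" for h :: "'b \<Rightarrow> 'a"
    using sum.reindex_bij_betw[OF e, of h] by simp
  define R :: "nat \<Rightarrow> nat" where "R s = (if s = 0 \<or> s = d then 1 else card I)" for s
  \<comment> \<open>Each core shifts the argument by the contribution \<open>i * 2 ^ (d - s)\<close>
    of its bit. The first core also absorbs the coefficients \<open>c\<close>; the last one, whose
    bit has weight 1, evaluates the basis function. As \<open>1 < d\<close>, these two cases never
    collide.\<close>
  define G :: "nat \<Rightarrow> nat \<Rightarrow> nat \<Rightarrow> nat \<Rightarrow> 'a" where
    "G s \<alpha> i \<beta> =
       (if s = 1 then \<Sum>a\<in>I. c a * A (i * 2 ^ (d - 1)) a (e \<beta>)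
        else if s = d then \<phi> (e \<alpha>) i
        else A (i * 2 ^ (d - s)) (e \<alpha>) (e \<beta>))" for s \<alpha> i \<beta>
  have "F (index_value d is)
      = (\<Sum>\<alpha>\<in>(\<Pi>\<^sub>E s\<in>{0..d}. {1..R s}). \<Prod>s=1..d. G s (\<alpha> (s - 1)) (is ! (s - 1)) (\<alpha> s))" for "is"
  proof -
    define v where "v s = (\<Sum>s'=Suc s..d. is ! (s' - 1) * 2 ^ (d - s'))" for s
    have v_step: "v s = is ! s * 2 ^ (d - Suc s) + v (Suc s)" if "s < d" for s
      unfolding v_def using that by (subst sum.atLeast_Suc_atMost) auto
    \<comment> \<open>\<open>v s\<close> is the number formed by the last \<open>d - s\<close> bits,
      so \<open>u s\<close> is the part of the train still to be contracted: the basis functions at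
      \<open>v s\<close>, with a single entry at either end.\<close>
    define u where
      "u s \<alpha> = (if s = 0 then F (v 0) else if s = d then 1 else \<phi> (e \<alpha>) (v s))" for s \<alpha>
    have "(\<Sum>\<alpha>\<in>(\<Pi>\<^sub>E s\<in>{0..d}. {1..R s}).
             (\<Prod>s=1..d. G s (\<alpha> (s - 1)) (is ! (s - 1)) (\<alpha> s)) * u d (\<alpha> d))
        = (\<Sum>\<alpha>\<in>{1..R 0}. u 0 \<alpha>)"
    proof (rule sum_paths_transfer[where H = "\<lambda>s \<alpha> \<beta>. G s \<alpha> (is ! (s - 1)) \<beta>"])
      fix t \<alpha> assume t: "t < d" and \<alpha>: "\<alpha> \<in> {1..R t}"
      consider "t = 0" | "t \<noteq> 0" "Suc t = d" | "t \<noteq> 0" "Suc t \<noteq> d" by blast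
      then show "u t \<alpha> = (\<Sum>\<beta>\<in>{1..R (Suc t)}. G (Suc t) \<alpha> (is ! (Suc t - 1)) \<beta> * u (Suc t) \<beta>)"
      proof cases
        case 1
        have "F (v 0) = (\<Sum>a\<in>I. \<Sum>b\<in>I. c a * A (is ! 0 * 2 ^ (d - 1)) a b * \<phi> b (v 1))"
          using t 1 s by (simp add: v_step[of 0] F shift sum_distrib_left mult.assoc)
        also have "\<dots> = (\<Sum>b\<in>I. (\<Sum>a\<in>I. c a * A (is ! 0 * 2 ^ (d - 1)) a b) * \<phi> b (v 1))"
          by (subst sum.swap) (simp add: sum_distrib_right)
        finally show ?thesis using 1 s by (simp add: u_def G_def R_def sum_e)
      next
        case 2
        have "v t = is ! t" using 2 t by (simp add: v_def flip: 2(2))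
        then show ?thesis using 2 t by (auto simp: u_def G_def R_def simp flip: 2(2))
      next
        case 3
        then have "e \<alpha> \<in> I" using \<alpha> t by (intro e_in) (simp add: R_def)
        then show ?thesis using 3 t by (simp add: u_def G_def R_def v_step[OF t] shift sum_e)
      qed
    qed
    moreover have "v 0 = index_value d is" by (simp add: v_def index_value_def)
    ultimately show ?thesis using s by (simp add: u_def R_def)
  qed
  then have "tt_decomposition d R G (\<lambda>is. F (index_value d is))"
    by (simp add: tt_decomposition_def R_def)
  moreover have "R s = card I" using s by (simp add: R_def)
  ultimately show ?thesis
    unfolding tt_rank_def by (intro Least_le) blast
qed

section \<open>Expansions of powers\<close>

text \<open>In the binomial expansion about \<open>t0\<close>, every term of order
  \<open>l >= m\<close> carries a factor \<open>(1 / 2) ^ l\<close>, at most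
  \<open>(1 / 2) ^ m\<close>. The remaining factors are dominated by the full expansion of
  \<open>(\<bar>t0\<bar> + r) ^ n\<close>.\<close>

lemma abs_power_minus_taylor_le:
  fixes t t0 r :: real
  assumes "\<bar>t - t0\<bar> \<le> r / 2"
  shows "\<bar>t ^ n - (\<Sum>l<m. real (n choose l) * t0 ^ (n - l) * (t - t0) ^ l)\<bar> \<le> (1 / 2) ^ m * (\<bar>t0\<bar> + r) ^ n"
proof -
  let ?a = "\<lambda>l. real (n choose l) * t0 ^ (n - l) * (t - t0) ^ l"
  have r: "r \<ge> 0" using assms by linarith
  have "t ^ n = ((t - t0) + t0) ^ n" by simp
  also have "\<dots> = (\<Sum>l\<le>n. ?a l)"
    by (subst binomial_ring) (simp add: ac_simps)
  \<comment> \<open>Terms with \<open>l > n\<close> vanish; padding the range makes it split at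
    \<open>m\<close> even when \<open>m > n\<close>.\<close>
  also have "\<dots> = (\<Sum>l<m+n+1. ?a l)"
    by (intro sum.mono_neutral_left) auto
  also have "\<dots> = (\<Sum>l<m. ?a l) + (\<Sum>l=m..<m+n+1. ?a l)"
    using sum.atLeastLessThan_concat[of 0 m "m+n+1" ?a] by (simp add: atLeast0LessThan)
  finally have "\<bar>t ^ n - (\<Sum>l<m. ?a l)\<bar> = \<bar>\<Sum>l=m..<m+n+1. ?a l\<bar>" by simp
  also have "\<dots> \<le> (\<Sum>l=m..<m+n+1. \<bar>?a l\<bar>)" by (rule sum_abs)
  also have "\<dots> \<le> (\<Sum>l=m..<m+n+1. (1 / 2) ^ m * (real (n choose l) * \<bar>t0\<bar> ^ (n - l) * r ^ l))"
  proof (rule sum_mono)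
    fix l assume l: "l \<in> {m..<m+n+1}"
    have "\<bar>t - t0\<bar> ^ l \<le> (r / 2) ^ l" using assms by (intro power_mono) auto
    also have "\<dots> = (1 / 2) ^ l * r ^ l" by (simp add: power_divide)
    also have "\<dots> \<le> (1 / 2) ^ m * r ^ l"
      using l r by (intro mult_right_mono power_decreasing) auto
    finally have "\<bar>t - t0\<bar> ^ l \<le> (1 / 2) ^ m * r ^ l" .
    then have "real (n choose l) * \<bar>t0\<bar> ^ (n - l) * \<bar>t - t0\<bar> ^ l \<le> real (n choose l) * \<bar>t0\<bar> ^ (n - l) * ((1 / 2) ^ m * r ^ l)"
      by (intro mult_left_mono) auto
    then show "\<bar>?a l\<bar> \<le> (1 / 2) ^ m * (real (n choose l) * \<bar>t0\<bar> ^ (n - l) * r ^ l)"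
      by (simp add: abs_mult power_abs ac_simps)
  qed
  also have "\<dots> \<le> (\<Sum>l<m+n+1. (1 / 2) ^ m * (real (n choose l) * \<bar>t0\<bar> ^ (n - l) * r ^ l))"
    using r by (intro sum_mono2) auto
  also have "\<dots> = (1 / 2) ^ m * (\<Sum>l\<le>n. real (n choose l) * \<bar>t0\<bar> ^ (n - l) * r ^ l)"
    unfolding sum_distrib_left[symmetric] by (intro arg_cong2[of _ _ _ _ "(*)"] refl sum.mono_neutral_right) auto
  also have "(\<Sum>l\<le>n. real (n choose l) * \<bar>t0\<bar> ^ (n - l) * r ^ l) = (\<bar>t0\<bar> + r) ^ n"
    by (subst add.commute, subst binomial_ring) (simp add: ac_simps)
  finally show ?thesis .
qed

text \<open>The function \<open>(n choose l) * x ^ (n - l)\<close> is the Hasse derivative of order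
  \<open>l\<close> of \<open>x ^ n\<close>. This is its Leibniz rule for
  \<open>x ^ k * x ^ n\<close>, that is, Vandermonde's identity. It shows that the family with
  \<open>l < m\<close> is closed under shifts of \<open>n\<close>.\<close>

lemma binomial_power_add:
  fixes x :: "'a::comm_semiring_1"
  assumes "l < m"
  shows "of_nat ((k + n) choose l) * x ^ (k + n - l) =
    (\<Sum>i<m. (if i \<le> l then of_nat (k choose (l - i)) * x ^ (k - (l - i)) else 0) * (of_nat (n choose i) * x ^ (n - i)))"
proof -
  have "((k + n) choose l) = (\<Sum>i\<le>l. (n choose i) * (k choose (l - i)))"
    by (metis vandermonde add.commute)
  then have "of_nat ((k + n) choose l) * x ^ (k + n - l) = (\<Sum>i\<le>l. of_nat ((n choose i) * (k choose (l - i))) * x ^ (k + n - l))"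
    by (simp add: sum_distrib_right)
  also have "\<dots> = (\<Sum>i\<le>l. of_nat (k choose (l - i)) * x ^ (k - (l - i)) * (of_nat (n choose i) * x ^ (n - i)))"
  proof (rule sum.cong[OF refl])
    fix i assume i: "i \<in> {..l}"
    show "of_nat ((n choose i) * (k choose (l - i))) * x ^ (k + n - l) = of_nat (k choose (l - i)) * x ^ (k - (l - i)) * (of_nat (n choose i) * x ^ (n - i))"
    \<comment> \<open>Truncated subtraction can spoil the addition of exponents only where one of
      the two binomial coefficients is zero.\<close>
    proof (cases "i \<le> n \<and> l - i \<le> k")
      case True
      then have "k + n - l = (k - (l - i)) + (n - i)" using i by auto
      then show ?thesis by (simp add: power_add ac_simps)
    qed (auto simp: not_le binomial_eq_0)
  qed
  also have "\<dots> = (\<Sum>i<m. (if i \<le> l then of_nat (k choose (l - i)) * x ^ (k - (l - i)) else 0) * (of_nat (n choose i) * x ^ (n - i)))"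
    using assms by (intro sum.mono_neutral_cong_left) auto
  finally show ?thesis .
qed

section \<open>Bessel's inequality\<close>

lemma integral_cos_period:
  fixes n :: int
  shows "integral {0..2 * pi} (\<lambda>t. cos (of_int n * t)) = (if n = 0 then 2 * pi else 0)"
proof (cases "n = 0")
  case False
  have "((\<lambda>t. cos (of_int n * t)) has_integral (sin (of_int n * (2 * pi)) / of_int n - sin (of_int n * 0) / of_int n)) {0..2 * pi}"
    using False by (intro fundamental_theorem_of_calculus)
      (auto intro!: derivative_eq_intros simp flip: has_real_derivative_iff_has_vector_derivative)
  moreover have "sin (of_int n * (2 * pi)) = 0"
    using sin_times_pi_eq_0[of "of_int n * 2"] by (simp add: mult.assoc)
  ultimately show ?thesis using False by (simp add: integral_unique)
qed simp

text \<open>Pair \<open>g\<close> with the trigonometric polynomial \<open>P\<close> whose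
  coefficients are the \<open>f k\<close>. Since these are real, the integrals of
  \<open>g * P\<close> and of the squared norm of \<open>P\<close> both equal
  \<open>2 * pi * S\<close>, and the pointwise inequality between arithmetic and geometric mean
  compares them.\<close>

lemma bessel_inequality_fourier_coeff:
  fixes f :: "nat \<Rightarrow> real"
  assumes meas: "g \<in> borel_measurable lebesgue"
    and bound: "AE t in lebesgue. norm (g t) \<le> M"
    and coeff: "\<And>k. k \<in> A \<Longrightarrow> complex_of_real (f k) = fourier_coeff g k"
    and A: "finite A"
  shows "(\<Sum>k\<in>A. (f k)\<^sup>2) \<le> M\<^sup>2"
proof -
  let ?J = "{0..2 * pi}"
  define S where "S = (\<Sum>k\<in>A. (f k)\<^sup>2)"
  define P where "P t = (\<Sum>k\<in>A. complex_of_real (f k) * exp (- (\<i> * of_nat k * of_real t)))" for t :: real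
  have exp_norm: "norm (exp (- (\<i> * of_nat k * of_real t))) = 1" for k :: nat and t :: real
    by (simp add: norm_exp_eq_Re)
  have cont: "continuous_on UNIV (\<lambda>t::real. exp (- (\<i> * of_nat k * of_real t)))" for k :: nat
    by (intro continuous_intros)
  have int_g: "set_integrable lebesgue ?J (\<lambda>t. g t * exp (- (\<i> * of_nat k * of_real t)))" for k :: nat
    unfolding set_integrable_def
  proof (rule Bochner_Integration.integrable_bound)
    show "integrable lebesgue (\<lambda>t. indicator ?J t *\<^sub>R M)"
      using absolutely_integrable_continuous_real[of 0 "2 * pi" "\<lambda>_. M"]
      by (simp add: set_integrable_def)
    have "(\<lambda>t::real. exp (- (\<i> * of_nat k * of_real t))) \<in> borel_measurable lebesgue"
      using cont by (intro measurable_completion) (simp add: borel_measurable_continuous_onI)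
    then show "(\<lambda>t. indicator ?J t *\<^sub>R (g t * exp (- (\<i> * of_nat k * of_real t)))) \<in> borel_measurable lebesgue"
      using meas by (intro borel_measurable_scaleR borel_measurable_indicator borel_measurable_times) auto
    show "AE t in lebesgue. norm (indicator ?J t *\<^sub>R (g t * exp (- (\<i> * of_nat k * of_real t)))) \<le> norm (indicator ?J t *\<^sub>R M)"
      using bound by eventually_elim (auto simp: norm_mult exp_norm indicator_def)
  qed
  have gP: "g t * P t = (\<Sum>k\<in>A. of_real (f k) * (g t * exp (- (\<i> * of_nat k * of_real t))))" for t
    by (simp add: P_def sum_distrib_left ac_simps)
  have int_gP: "set_integrable lebesgue ?J (\<lambda>t. g t * P t)"
    using set_integrable_mult_right[OF int_g]
    unfolding gP set_integrable_def scaleR_sum_right by (intro Bochner_Integration.integrable_sum)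
  have "(LINT t:?J|lebesgue. g t * P t) = (\<Sum>k\<in>A. of_real (f k) * (LINT t:?J|lebesgue. g t * exp (- (\<i> * of_nat k * of_real t))))"
    using set_integrable_mult_right[OF int_g]
    unfolding gP set_integrable_def set_integral_mult_right[symmetric] unfolding set_lebesgue_integral_def scaleR_sum_right
    by (intro Bochner_Integration.integral_sum)
  also have "\<dots> = (\<Sum>k\<in>A. complex_of_real (f k) * (2 * complex_of_real pi * complex_of_real (f k)))"
    by (intro sum.cong refl) (simp add: coeff fourier_coeff_def)
  also have "\<dots> = of_real (2 * pi * S)"
    by (simp add: S_def sum_distrib_left power2_eq_square ac_simps)
  finally have val: "(LINT t:?J|lebesgue. g t * P t) = of_real (2 * pi * S)" .
  have S0: "S \<ge> 0" unfolding S_def by (intro sum_nonneg) auto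
  have P2: "(norm (P t))\<^sup>2 = (\<Sum>k\<in>A. \<Sum>l\<in>A. f k * f l * cos (of_int (int k - int l) * t))" for t
  proof -
    have Re: "Re (P t) = (\<Sum>k\<in>A. f k * cos (k * t))" and Im: "Im (P t) = - (\<Sum>k\<in>A. f k * sin (k * t))"
      by (simp_all add: P_def Re_exp Im_exp sum_negf)
    show ?thesis
      unfolding cmod_power2 Re Im power2_minus unfolding power2_eq_square sum_product sum.distrib[symmetric]
      by (intro sum.cong refl) (simp add: left_diff_distrib cos_diff algebra_simps)
  qed
  have cont_P2: "continuous_on ?J (\<lambda>t. (norm (P t))\<^sup>2)"
    unfolding P_def by (intro continuous_intros)
  have "integral ?J (\<lambda>t. (norm (P t))\<^sup>2) = (\<Sum>k\<in>A. \<Sum>l\<in>A. f k * f l * (if int k - int l = 0 then 2 * pi else 0))"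
    unfolding P2 integral_cos_period[symmetric] using A
    by (simp add: integral_sum integrable_continuous_real integrable_sum continuous_intros del: of_int_diff)
  also have "\<dots> = (\<Sum>k\<in>A. \<Sum>l\<in>A. if k = l then 2 * pi * (f k)\<^sup>2 else 0)"
    by (intro sum.cong refl) (auto simp: power2_eq_square)
  also have "\<dots> = 2 * pi * S" using A by (simp add: S_def sum_distrib_left)
  finally have int_P2: "integral ?J (\<lambda>t. (norm (P t))\<^sup>2) = 2 * pi * S" .
  have cont2: "continuous_on ?J (\<lambda>t. (M\<^sup>2 + (norm (P t))\<^sup>2) / 2)"
    by (intro continuous_intros cont_P2) auto
  have "2 * pi * S = norm (LINT t:?J|lebesgue. g t * P t)"
    unfolding val using S0 by (simp only: norm_of_real) simp
  also have "\<dots> \<le> (LINT t:?J|lebesgue. norm (g t * P t))"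
    by (rule set_integral_norm_bound[OF int_gP])
  also have "\<dots> \<le> (LINT t:?J|lebesgue. (M\<^sup>2 + (norm (P t))\<^sup>2) / 2)"
    unfolding set_lebesgue_integral_def
  proof (rule integral_mono_AE)
    show "integrable lebesgue (\<lambda>t. indicator ?J t *\<^sub>R norm (g t * P t))"
      using set_integrable_norm[OF int_gP] by (simp add: set_integrable_def)
    show "integrable lebesgue (\<lambda>t. indicator ?J t *\<^sub>R ((M\<^sup>2 + (norm (P t))\<^sup>2) / 2))"
      using absolutely_integrable_continuous_real[OF cont2] by (simp add: set_integrable_def)
    show "AE t in lebesgue. indicator ?J t *\<^sub>R norm (g t * P t) \<le> indicator ?J t *\<^sub>R ((M\<^sup>2 + (norm (P t))\<^sup>2) / 2)"
      using bound
    proof eventually_elim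
      fix t assume "norm (g t) \<le> M"
      then have "norm (g t * P t) \<le> M * norm (P t)" by (simp add: norm_mult mult_right_mono)
      also have "\<dots> \<le> (M\<^sup>2 + (norm (P t))\<^sup>2) / 2"
        using sum_squares_bound[of M "norm (P t)"] by simp
      finally show "indicator ?J t *\<^sub>R norm (g t * P t) \<le> indicator ?J t *\<^sub>R ((M\<^sup>2 + (norm (P t))\<^sup>2) / 2)"
        by (simp add: indicator_def)
    qed
  qed
  also have "\<dots> = integral ?J (\<lambda>t. (M\<^sup>2 + (norm (P t))\<^sup>2) / 2)"
    by (intro set_lebesgue_integral_eq_integral absolutely_integrable_continuous_real cont2)
  \<comment> \<open>Half of the left-hand side reappears here and is absorbed.\<close>
  also have "\<dots> = (2 * pi * M\<^sup>2 + 2 * pi * S) / 2"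
    by (simp add: integral_add integrable_continuous_real cont_P2 int_P2)
  finally have "2 * pi * S \<le> 2 * pi * M\<^sup>2" by simp
  then show ?thesis by (simp add: S_def)
qed

section \<open>Mass bounds from square-summable moments\<close>

text \<open>Serves to read off finiteness of the measure from its zeroth moment.\<close>

lemma finite_measure_if_integrable_one:
  assumes "integrable \<mu> (\<lambda>_. 1 :: real)"
  shows "finite_measure \<mu>"
  using assms by (intro finite_measureI) (simp add: integrable_iff_bounded less_top[symmetric])

text \<open>Mass at distance at least \<open>c\<close> from 0 forces the moment of order
  \<open>2 * n\<close> to be at least \<open>c ^ (2 * n)\<close> times that mass. Squaring and
  summing gives a geometric series in \<open>c ^ 4\<close>, so the squared mass is at most
  \<open>(1 - c ^ 4) * B\<close>.\<close>

lemma measure_sq_le_moments: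
  fixes \<mu> :: "real measure"
  assumes sets: "sets \<mu> = sets borel"
    and int: "\<And>n. integrable \<mu> (\<lambda>t. t ^ n)"
    and bound: "\<And>K. (\<Sum>n<K. (LINT t|\<mu>. t ^ n)\<^sup>2) \<le> B"
    and S: "S \<in> sets borel" "\<And>t. t \<in> S \<Longrightarrow> c \<le> \<bar>t\<bar>"
    and c: "0 \<le> c" "c \<le> 1"
  shows "(measure \<mu> S)\<^sup>2 \<le> 4 * (1 - c) * B"
proof -
  let ?w = "measure \<mu> S"
  have S': "S \<in> sets \<mu>" using S sets by simp
  interpret finite_measure \<mu> using int[of 0] by (intro finite_measure_if_integrable_one) simp
  \<comment> \<open>Only even orders are used: their integrands are nonnegative, so discarding the
    complement of \<open>S\<close> cannot increase the integral.\<close>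
  have even_moment: "?w * c ^ (2 * n) \<le> (LINT t|\<mu>. t ^ (2 * n))" for n
  proof -
    have "?w * c ^ (2 * n) = (LINT t|\<mu>. indicator S t * c ^ (2 * n))"
      using S' by simp
    also have "\<dots> \<le> (LINT t|\<mu>. t ^ (2 * n))"
    proof (rule integral_mono)
      show "integrable \<mu> (\<lambda>t. indicator S t * c ^ (2 * n))"
        using S' by (intro integrable_mult_left integrable_real_indicator) (auto simp: emeasure_finite less_top[symmetric])
      fix t
      have "c ^ (2 * n) \<le> \<bar>t\<bar> ^ (2 * n)" if "t \<in> S" using S(2)[OF that] c by (intro power_mono)
      then show "indicator S t * c ^ (2 * n) \<le> t ^ (2 * n)"
        by (auto simp: indicator_def power_even_abs zero_le_even_power)
    qed (rule int)
    finally show ?thesis .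
  qed
  have partial: "?w\<^sup>2 * (\<Sum>n<L. (c ^ 4) ^ n) \<le> B" for L
  proof -
    have "?w\<^sup>2 * (\<Sum>n<L. (c ^ 4) ^ n) = (\<Sum>n<L. (?w * c ^ (2 * n))\<^sup>2)"
      by (simp add: sum_distrib_left power_mult_distrib flip: power_mult)
    also have "\<dots> \<le> (\<Sum>n<L. (LINT t|\<mu>. t ^ (2 * n))\<^sup>2)"
      using c by (intro sum_mono power_mono even_moment) auto
    also have "\<dots> = (\<Sum>n\<in>(*) 2 ` {..<L}. (LINT t|\<mu>. t ^ n)\<^sup>2)"
      by (subst sum.reindex) (auto intro: inj_onI)
    also have "\<dots> \<le> (\<Sum>n<2*L. (LINT t|\<mu>. t ^ n)\<^sup>2)"
      by (intro sum_mono2) auto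
    also have "\<dots> \<le> B" by (rule bound)
    finally show ?thesis .
  qed
  have B0: "B \<ge> 0" using bound[of 0] by simp
  show ?thesis
  proof (cases "c = 1")
    case True
    \<comment> \<open>At \<open>c = 1\<close> the series diverges: \<open>L\<close> times the
      squared mass stays below \<open>B\<close> for every \<open>L\<close>.\<close>
    have "?w\<^sup>2 \<le> 0"
    proof (rule ccontr)
      assume "\<not> ?w\<^sup>2 \<le> 0"
      then obtain L where "B < of_nat L * ?w\<^sup>2" using ex_less_of_nat_mult[of "?w\<^sup>2" B] by auto
      then show False using partial[of L] True by (simp add: mult.commute)
    qed
    then show ?thesis using True by simp
  next
    case False
    define x where "x = c ^ 4"
    have x: "0 \<le> x" "x < 1" using False c power_less_one_iff[of c 4] by (auto simp: x_def)
    have "?w\<^sup>2 * (1 - x ^ L) \<le> B * (1 - x)" for L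
    proof -
      have "?w\<^sup>2 * (1 - x ^ L) = ?w\<^sup>2 * (\<Sum>n<L. x ^ n) * (1 - x)"
        using x one_diff_power_eq[of x L] by (simp add: ac_simps)
      also have "\<dots> \<le> B * (1 - x)" using partial[of L] x by (intro mult_right_mono) (auto simp: x_def)
      finally show ?thesis .
    qed
    moreover have "(\<lambda>L. ?w\<^sup>2 * (1 - x ^ L)) \<longlonglongrightarrow> ?w\<^sup>2 * (1 - 0)"
      using x by (intro tendsto_intros LIMSEQ_power_zero) auto
    ultimately have "?w\<^sup>2 \<le> B * (1 - x)"
      by (intro LIMSEQ_le_const2[of _ "?w\<^sup>2"]) auto
    also have "1 - x \<le> 4 * (1 - c)"
      using Bernoulli_inequality[of "c - 1" 4] c by (simp add: x_def)
    then have "B * (1 - x) \<le> B * (4 * (1 - c))" using B0 by (rule mult_left_mono)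
    finally show ?thesis by (simp add: ac_simps)
  qed
qed

section \<open>Blockwise Taylor approximation of the moments\<close>

lemma integrable_shifted_power:
  fixes \<mu> :: "real measure"
  assumes "\<And>n. integrable \<mu> (\<lambda>t. t ^ n)"
  shows "integrable \<mu> (\<lambda>t. (t - a) ^ n)"
proof -
  have "(\<lambda>t. (t - a) ^ n) = (\<lambda>t. \<Sum>k\<le>n. of_nat (n choose k) * t ^ k * (- a) ^ (n - k))"
    using binomial_ring[of _ "- a" n] by simp
  then show ?thesis using assms by simp
qed

text \<open>The squared mass of \<open>S\<close> is at most \<open>4 * h * B\<close>, while the
  powers in the remainder may sum to \<open>4 / h\<close>. The two factors \<open>h\<close> cancel,
  so the bound does not deteriorate for blocks close to 1 or -1.\<close>

lemma block_taylor_error: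
  fixes \<mu> :: "real measure"
  assumes sets: "sets \<mu> = sets borel"
    and int: "\<And>n. integrable \<mu> (\<lambda>t. t ^ n)"
    and bound: "\<And>K. (\<Sum>n<K. (LINT t|\<mu>. t ^ n)\<^sup>2) \<le> B"
    and S: "S \<in> sets borel" "\<And>t. t \<in> S \<Longrightarrow> 1 - h \<le> \<bar>t\<bar>" "\<And>t. t \<in> S \<Longrightarrow> \<bar>t - t0\<bar> \<le> r / 2"
    and h: "0 < h" "h \<le> 1" and r: "0 \<le> r"
    and geom: "(\<Sum>n<N. ((\<bar>t0\<bar> + r) ^ n)\<^sup>2) \<le> 4 / h"
  shows "(\<Sum>n<N. ((LINT t|\<mu>. indicator S t * t ^ n)
      - (\<Sum>l<m. real (n choose l) * t0 ^ (n - l) * (LINT t|\<mu>. indicator S t * (t - t0) ^ l)))\<^sup>2) \<le> 16 * B / 4 ^ m"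
proof -
  let ?w = "measure \<mu> S"
  have S': "S \<in> sets \<mu>" using S sets by simp
  interpret finite_measure \<mu> using int[of 0] by (intro finite_measure_if_integrable_one) simp
  have w: "?w\<^sup>2 \<le> 4 * h * B"
    using measure_sq_le_moments[OF sets int bound S(1,2)] h by simp
  have int_S: "integrable \<mu> (\<lambda>t. indicator S t * (t - a) ^ n)" for a n
    using integrable_mult_indicator[OF S' integrable_shifted_power[OF int, of a n]] by simp
  have int_S0: "integrable \<mu> (\<lambda>t. indicator S t * t ^ n)" for n
    using int_S[of 0 n] by simp
  have pointwise: "\<bar>(LINT t|\<mu>. indicator S t * t ^ n)
      - (\<Sum>l<m. real (n choose l) * t0 ^ (n - l) * (LINT t|\<mu>. indicator S t * (t - t0) ^ l))\<bar>
      \<le> ?w * ((1 / 2) ^ m * (\<bar>t0\<bar> + r) ^ n)" for n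
  proof -
    have "(LINT t|\<mu>. indicator S t * t ^ n)
        - (\<Sum>l<m. real (n choose l) * t0 ^ (n - l) * (LINT t|\<mu>. indicator S t * (t - t0) ^ l))
      = (LINT t|\<mu>. indicator S t * t ^ n - (\<Sum>l<m. real (n choose l) * t0 ^ (n - l) * (indicator S t * (t - t0) ^ l)))"
      using int_S int_S0 by (simp add: Bochner_Integration.integral_diff Bochner_Integration.integral_sum)
    also have "\<bar>\<dots>\<bar> \<le> (LINT t|\<mu>. indicator S t * ((1 / 2) ^ m * (\<bar>t0\<bar> + r) ^ n))"
    proof (rule Bochner_Integration.integral_abs_bound_integral)
      show "integrable \<mu> (\<lambda>t. indicator S t * t ^ n - (\<Sum>l<m. real (n choose l) * t0 ^ (n - l) * (indicator S t * (t - t0) ^ l)))"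
        using int_S int_S0 by simp
      show "integrable \<mu> (\<lambda>t. indicator S t * ((1 / 2) ^ m * (\<bar>t0\<bar> + r) ^ n))"
        using S' by (intro integrable_mult_left integrable_real_indicator) (auto simp: emeasure_finite less_top[symmetric])
      fix t
      show "\<bar>indicator S t * t ^ n - (\<Sum>l<m. real (n choose l) * t0 ^ (n - l) * (indicator S t * (t - t0) ^ l))\<bar>
          \<le> indicator S t * ((1 / 2) ^ m * (\<bar>t0\<bar> + r) ^ n)"
        using abs_power_minus_taylor_le[OF S(3), of t n m] by (cases "t \<in> S") auto
    qed
    also have "\<dots> = ?w * ((1 / 2) ^ m * (\<bar>t0\<bar> + r) ^ n)"
      using S' by simp
    finally show ?thesis .
  qed
  have "(\<Sum>n<N. ((LINT t|\<mu>. indicator S t * t ^ n)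
      - (\<Sum>l<m. real (n choose l) * t0 ^ (n - l) * (LINT t|\<mu>. indicator S t * (t - t0) ^ l)))\<^sup>2)
      \<le> (\<Sum>n<N. (?w * ((1 / 2) ^ m * (\<bar>t0\<bar> + r) ^ n))\<^sup>2)"
    using pointwise by (intro sum_mono) (meson abs_le_square_iff abs_ge_self order_trans)
  also have "\<dots> = ?w\<^sup>2 * (\<Sum>n<N. ((\<bar>t0\<bar> + r) ^ n)\<^sup>2) / 4 ^ m"
  proof -
    have "((1 / 2 :: real) ^ m)\<^sup>2 = 1 / 4 ^ m"
      by (simp add: power_divide power2_eq_square flip: power_mult_distrib)
    then show ?thesis
      by (simp add: power_mult_distrib sum_distrib_left sum_divide_distrib ac_simps)
  qed
  also have "\<dots> \<le> (4 * h * B) * (4 / h) / 4 ^ m"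
    using w geom h bound[of 0] by (intro divide_right_mono mult_mono) (auto intro: sum_nonneg)
  also have "\<dots> = 16 * B / 4 ^ m" using h by simp
  finally show ?thesis .
qed

lemma sum_indicator_consecutive:
  fixes a :: "nat \<Rightarrow> 'a::linorder"
  assumes "incseq a" "\<And>j. a j \<le> b"
  shows "(\<Sum>j\<le>d. indicator {a j..<(if j = d then b else a (Suc j))} x) = (indicator {a 0..<b} x :: real)"
proof -
  \<comment> \<open>The last cell is kept apart, so that the induction step merely cuts
    \<open>{a d..<b}\<close> at \<open>a (Suc d)\<close>.\<close>
  have "(\<Sum>j<d. indicator {a j..<a (Suc j)} x) + indicator {a d..<b} x = (indicator {a 0..<b} x :: real)"
  proof (induction d)
    case (Suc d)
    have "indicator {a d..<a (Suc d)} x + indicator {a (Suc d)..<b} x = (indicator {a d..<b} x :: real)"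
      using incseq_SucD[OF assms(1), of d] assms(2)[of "Suc d"] by (auto simp: indicator_def)
    then show ?case using Suc by simp
  qed simp
  then show ?thesis by (simp flip: lessThan_Suc_atMost)
qed

text \<open>Replacing \<open>x ^ (2 * n)\<close> by \<open>x ^ n\<close> costs at most a factor 2.
  At \<open>x = 1 - h / 4\<close> the result is exactly the \<open>4 / h\<close> wanted for a
  block.\<close>

lemma sum_power_sq_le_geometric:
  fixes x :: real
  assumes "0 \<le> x" "x < 1"
  shows "(\<Sum>n<N. (x ^ n)\<^sup>2) \<le> 1 / (1 - x)"
proof -
  have "(\<Sum>n<N. (x ^ n)\<^sup>2) \<le> (\<Sum>n<N. x ^ n)"
    using assms by (intro sum_mono) (simp add: power2_eq_square mult_left_le power_le_one)
  also have "\<dots> = (1 - x ^ N) / (1 - x)"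
    using assms one_diff_power_eq[of x N] by (simp add: field_simps)
  also have "\<dots> \<le> 1 / (1 - x)" using assms by (intro divide_right_mono) auto
  finally show ?thesis .
qed

text \<open>Below \<open>N\<close> every squared power is at most
  \<open>(1 + 1 / (2 * N)) ^ (2 * N)\<close>, hence at most \<open>exp 1\<close>. With
  \<open>N = 2 ^ d\<close> this is the bound \<open>4 / h\<close> for the last block, where
  \<open>h = 1 / 2 ^ d\<close>.\<close>

lemma sum_power_sq_le_near_one:
  assumes "0 < N"
  shows "(\<Sum>n<N. ((1 + 1 / (2 * real N)) ^ n)\<^sup>2) \<le> 4 * real N"
proof -
  have "((1 + 1 / (2 * real N)) ^ n)\<^sup>2 \<le> 4" if "n < N" for n
  proof -
    have "((1 + 1 / (2 * real N)) ^ n)\<^sup>2 = (1 + 1 / (2 * real N)) ^ (2 * n)"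
      by (simp add: power_mult mult.commute)
    also have "\<dots> \<le> (1 + 1 / (2 * real N)) ^ (2 * N)"
      using that by (intro power_increasing) auto
    also have "\<dots> \<le> exp 1"
      using exp_ge_one_plus_x_over_n_power_n[of "2 * N" 1] assms by simp
    also have "\<dots> \<le> 4" using exp_le by simp
    finally show ?thesis .
  qed
  then have "(\<Sum>n<N. ((1 + 1 / (2 * real N)) ^ n)\<^sup>2) \<le> (\<Sum>n<N. 4)"
    by (intro sum_mono) auto
  then show ?thesis by (simp add: mult.commute)
qed

text \<open>
  The base \<open>\<bar>z b\<bar> + r j\<close> of the remainder bound is \<open>1 - 2\<^sup>-\<^sup>j\<^sup>-\<^sup>2\<close> on the blocks \<open>j < d\<close>; on the last one,
  which reaches up to \<open>1\<close>, it is \<open>1 + 2\<^sup>-\<^sup>d\<^sup>-\<^sup>1\<close>, whose powers are bounded only because \<open>n < 2\<^sup>d\<close>.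
\<close>

lemma moments_exponential_polynomial_approx:
  fixes \<mu> :: "real measure"
  assumes sets: "sets \<mu> = sets borel"
    and int: "\<And>n. integrable \<mu> (\<lambda>t. t ^ n)"
    and bound: "\<And>K. (\<Sum>n<K. (LINT t|\<mu>. t ^ n)\<^sup>2) \<le> B"
  shows "\<exists>(z :: bool \<times> nat \<Rightarrow> real) c. (\<Sum>n<2 ^ d. ((LINT t|\<mu>. t ^ n)
      - (\<Sum>(b, l)\<in>(UNIV \<times> {..d}) \<times> {..<m}. c b l * (real (n choose l) * z b ^ (n - l))))\<^sup>2)
      \<le> (2 * (real d + 1))\<^sup>2 * (16 * B / 4 ^ m)"
proof -
  define a :: "nat \<Rightarrow> real" where "a j = 1 - (1 / 2) ^ j" for j
  define e where "e j = (if j = d then 1 else a (Suc j))" for j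
  \<comment> \<open>A block is given by a sign and a dyadic level; 0 counts as positive. Its length
    is \<open>r\<close> and its midpoint \<open>z\<close>, so its points lie within
    \<open>r / 2\<close> of \<open>z\<close>.\<close>
  define S where "S b = {t::real. (0 \<le> t) = fst b \<and> \<bar>t\<bar> \<in> {a (snd b)..<e (snd b)}}" for b
  define r where "r j = e j - a j" for j
  define z where "z b = (if fst b then 1 else -1) * ((a (snd b) + e (snd b)) / 2)" for b
  define c where "c b l = (LINT t|\<mu>. indicator (S b) t * (t - z b) ^ l)" for b l
  define E where "E b n = (LINT t|\<mu>. indicator (S b) t * t ^ n)
      - (\<Sum>l<m. real (n choose l) * z b ^ (n - l) * c b l)" for b n
  let ?B = "(UNIV :: bool set) \<times> {..d}"
  interpret finite_measure \<mu> using int[of 0] by (intro finite_measure_if_integrable_one) simp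
  have a_mono: "incseq a" unfolding a_def by (intro incseq_SucI) simp
  have a01: "0 \<le> a j" "a j \<le> 1" for j by (auto simp: a_def power_le_one)
  have e1: "e j \<le> 1" and e_ge: "a j \<le> e j" for j
    using a01 incseq_SucD[OF a_mono, of j] by (auto simp: e_def)
  have S_borel: "S b \<in> sets borel" for b
  proof -
    have "S b = {t. (0 \<le> t) = fst b} \<inter> {t. a (snd b) \<le> \<bar>t\<bar> \<and> \<bar>t\<bar> < e (snd b)}"
      by (auto simp: S_def)
    moreover have "{t::real. (0 \<le> t) = fst b} \<in> sets borel" by (cases "fst b") measurable
    ultimately show ?thesis by simp
  qed
  have z_abs: "\<bar>z b\<bar> = (a (snd b) + e (snd b)) / 2" for b
    using a01(1)[of "snd b"] e_ge[of "snd b"] by (simp add: z_def abs_mult)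
  have err: "(\<Sum>n<2 ^ d. (E b n)\<^sup>2) \<le> 16 * B / 4 ^ m" if b: "b \<in> ?B" for b
    unfolding E_def c_def
  proof (rule block_taylor_error[OF sets int bound S_borel])
    let ?j = "snd b"
    show "1 - (1 / 2) ^ ?j \<le> \<bar>t\<bar>" if "t \<in> S b" for t
      using that by (simp add: S_def a_def)
    show "\<bar>t - z b\<bar> \<le> r ?j / 2" if "t \<in> S b" for t
      using that by (auto simp: S_def z_def r_def field_simps split: if_splits)
    show "0 \<le> r ?j" using e_ge by (simp add: r_def)
    show "(\<Sum>n<2 ^ d. ((\<bar>z b\<bar> + r ?j) ^ n)\<^sup>2) \<le> 4 / (1 / 2) ^ ?j"
    proof (cases "?j = d")
      case True
      then have "\<bar>z b\<bar> + r ?j = 1 + 1 / (2 * real (2 ^ d))"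
        by (simp add: z_abs r_def e_def a_def power_divide field_simps)
      then show ?thesis
        using sum_power_sq_le_near_one[of "2 ^ d"] True by (simp add: power_divide)
    next
      case False
      then have "\<bar>z b\<bar> + r ?j = 1 - (1 / 2) ^ ?j / 4"
        by (simp add: z_abs r_def e_def a_def field_simps)
      then show ?thesis
        using sum_power_sq_le_geometric[of "1 - (1 / 2) ^ ?j / 4" "2 ^ d"] power_le_one[of "1 / 2 :: real" ?j]
        by simp
    qed
  qed (auto simp: power_le_one)
  \<comment> \<open>This is the mass bound at \<open>c = 1\<close>; beyond it the blocks cover
    everything.\<close>
  have null: "AE t in \<mu>. \<bar>t\<bar> < 1"
  proof -
    have S1: "{t::real. 1 \<le> \<bar>t\<bar>} \<in> sets borel" by measurable
    have "(measure \<mu> {t. 1 \<le> \<bar>t\<bar>})\<^sup>2 \<le> 4 * (1 - 1) * B"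
      by (rule measure_sq_le_moments[OF sets int bound S1]) auto
    then have "{t. 1 \<le> \<bar>t\<bar>} \<in> null_sets \<mu>"
      using S1 sets by (simp add: null_sets_def emeasure_eq_measure)
    then show ?thesis by (rule AE_I') (auto simp: not_less)
  qed
  have split: "(LINT t|\<mu>. t ^ n) = (\<Sum>b\<in>?B. LINT t|\<mu>. indicator (S b) t * t ^ n)" for n
  proof -
    have part: "(\<Sum>b\<in>?B. indicator (S b) t) = (1 :: real)" if "\<bar>t\<bar> < 1" for t
    proof -
      have "(\<Sum>b\<in>?B. indicator (S b) t :: real)
          = (\<Sum>\<sigma>\<in>UNIV. \<Sum>j\<le>d. if (0 \<le> t) = \<sigma> then indicator {a j..<e j} \<bar>t\<bar> else 0)"
        unfolding sum.cartesian_product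
        by (rule sum.cong[OF refl]) (clarsimp simp: S_def indicator_def)
      also have "\<dots> = (\<Sum>j\<le>d. indicator {a j..<e j} \<bar>t\<bar>)"
        by (cases "0 \<le> t") (simp_all add: UNIV_bool)
      also have "\<dots> = indicator {a 0..<1} \<bar>t\<bar>"
        unfolding e_def by (rule sum_indicator_consecutive[OF a_mono a01(2)])
      also have "\<dots> = 1" using that by (simp add: a_def)
      finally show ?thesis .
    qed
    have int_S: "integrable \<mu> (\<lambda>t. indicator (S b) t * t ^ n)" for b
      using integrable_mult_indicator[of "S b" \<mu>, OF _ int[of n]] S_borel sets by simp
    have "(LINT t|\<mu>. t ^ n) = (LINT t|\<mu>. (\<Sum>b\<in>?B. indicator (S b) t * t ^ n))"
    proof (rule integral_cong_AE)
      show "AE t in \<mu>. t ^ n = (\<Sum>b\<in>?B. indicator (S b) t * t ^ n)"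
        using null by eventually_elim (simp add: part flip: sum_distrib_right)
      show "(\<lambda>t. t ^ n) \<in> borel_measurable \<mu>" using int by (rule borel_measurable_integrable)
      show "(\<lambda>t. \<Sum>b\<in>?B. indicator (S b) t * t ^ n) \<in> borel_measurable \<mu>"
        using int_S by (intro borel_measurable_sum borel_measurable_integrable)
    qed
    also have "\<dots> = (\<Sum>b\<in>?B. LINT t|\<mu>. indicator (S b) t * t ^ n)"
      using int_S by (intro Bochner_Integration.integral_sum)
    finally show ?thesis .
  qed
  have total: "(LINT t|\<mu>. t ^ n) - (\<Sum>(b, l)\<in>?B \<times> {..<m}. c b l * (real (n choose l) * z b ^ (n - l)))
      = (\<Sum>b\<in>?B. E b n)" for n
    unfolding split E_def sum_subtractf sum.cartesian_product[symmetric]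
    by (simp add: ac_simps)
  have card: "card ?B = 2 * (d + 1)" by simp
  \<comment> \<open>The number of blocks enters squared: once from the Cauchy-Schwarz inequality for
    the sum over blocks, once from adding up the block errors.\<close>
  have "(\<Sum>n<2 ^ d. ((LINT t|\<mu>. t ^ n)
      - (\<Sum>(b, l)\<in>?B \<times> {..<m}. c b l * (real (n choose l) * z b ^ (n - l))))\<^sup>2)
      \<le> (\<Sum>n<2 ^ d. (\<Sum>b\<in>?B. (E b n)\<^sup>2) * card ?B)"
    unfolding total by (intro sum_mono sum_squared_le_sum_of_squares)
  also have "\<dots> = (\<Sum>b\<in>?B. \<Sum>n<2 ^ d. (E b n)\<^sup>2) * card ?B"
    unfolding sum_distrib_right[symmetric] by (subst sum.swap) simp
  also have "\<dots> \<le> (\<Sum>b\<in>?B. 16 * B / 4 ^ m) * card ?B"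
    by (intro mult_right_mono sum_mono err) auto
  also have "\<dots> = (2 * (real d + 1))\<^sup>2 * (16 * B / 4 ^ m)"
    unfolding sum_constant card by (simp add: power2_eq_square algebra_simps add_divide_distrib)
  finally show ?thesis by blast
qed

section \<open>Ranks of the approximant and choice of the parameters\<close>

lemma tt_rank_exponential_polynomial_le:
  fixes z :: "'b \<Rightarrow> 'a::comm_ring_1"
  assumes "finite B" "1 \<le> s" "s < d"
  shows "tt_rank d (\<lambda>is. \<Sum>(b, l)\<in>B \<times> {..<m}. c b l * (of_nat (index_value d is choose l) * z b ^ (index_value d is - l))) s
      \<le> card B * m"
proof -
  define \<phi> where "\<phi> = (\<lambda>(b, l) n. of_nat (n choose l) * z b ^ (n - l))"
  \<comment> \<open>A shift does not mix different nodes and never raises the order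
    \<open>l\<close>, so its matrix is block diagonal with triangular blocks.\<close>
  define A where "A k = (\<lambda>(b, l) (b', i).
      if b' = b \<and> i \<le> l then of_nat (k choose (l - i)) * z b ^ (k - (l - i)) else 0)" for k
  have "tt_rank d (\<lambda>is. (\<lambda>n. \<Sum>x\<in>B \<times> {..<m}. (case x of (b, l) \<Rightarrow> c b l) * \<phi> x n) (index_value d is)) s
      \<le> card (B \<times> {..<m})"
  proof (rule tt_rank_le_shift_invariant[where A = A])
    fix x n k assume "x \<in> B \<times> {..<m}"
    then obtain b l where x: "x = (b, l)" "b \<in> B" "l < m" by auto
    have "(\<Sum>y\<in>B \<times> {..<m}. A k x y * \<phi> y n) = (\<Sum>b'\<in>B. \<Sum>i<m. A k x (b', i) * \<phi> (b', i) n)"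
      by (simp add: sum.cartesian_product)
    also have "\<dots> = (\<Sum>b'\<in>B. if b' = b then \<Sum>i<m. A k x (b, i) * \<phi> (b, i) n else 0)"
      by (intro sum.cong) (auto simp: A_def x)
    also have "\<dots> = (\<Sum>i<m. A k x (b, i) * \<phi> (b, i) n)"
      using x assms by simp
    also have "\<dots> = \<phi> x (k + n)"
      using binomial_power_add[OF x(3), where x = "z b" and k = k and n = n] by (simp add: A_def \<phi>_def x)
    finally show "\<phi> x (k + n) = (\<Sum>y\<in>B \<times> {..<m}. A k x y * \<phi> y n)" ..
  qed (use assms in auto)
  then show ?thesis by (simp add: \<phi>_def case_prod_beta card_cartesian_product)
qed

theorem theorem1:
  shows "\<exists>C::real. C > 0 \<and>
    (\<forall>(f :: nat \<Rightarrow> real) (g :: real \<Rightarrow> complex) (M :: real).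
       hamburger_solvable f \<longrightarrow>
       essentially_bounded g \<longrightarrow>
       (\<exists>p>0. \<forall>t. g (t + p) = g t) \<longrightarrow>
       (\<forall>k\<ge>1. complex_of_real (f k) = fourier_coeff g k) \<longrightarrow>
       ereal M = ess_sup_norm g \<longrightarrow>
       (\<forall>(\<epsilon> :: real) (d :: nat). 0 < \<epsilon> \<longrightarrow> \<epsilon> < 1 \<longrightarrow> d \<ge> 1 \<longrightarrow>
          (\<exists>T :: nat list \<Rightarrow> real.
             (\<forall>s\<in>{1..<d}. real (tt_rank d T s) \<le>
                (if M = 0 then 0
                 else max 0 (C * real d * (ln (real d) + ln (1 / \<epsilon>) + ln M + 1)))) \<and>
             frobenius_norm d (\<lambda>is. Q d f is - T is) \<le> \<epsilon>)))"
proof (intro exI[of _ "20::real"] conjI allI impI)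
  fix f :: "nat \<Rightarrow> real" and g :: "real \<Rightarrow> complex" and M \<epsilon> :: real and d :: nat
  assume ham: "hamburger_solvable f" and ess: "essentially_bounded g"
    and coeff: "\<forall>k\<ge>1. complex_of_real (f k) = fourier_coeff g k"
    and M: "ereal M = ess_sup_norm g" and \<epsilon>: "0 < \<epsilon>" "\<epsilon> < 1" and d: "d \<ge> 1"
  have "AE t in lebesgue. ereal (norm (g t)) \<le> ereal M"
    unfolding M ess_sup_norm_def using ess
    by (intro esssup_AE)
  then have gM: "AE t in lebesgue. norm (g t) \<le> M" by simp
  \<comment> \<open>A negative bound would fail at every point, which is impossible almost
    everywhere for a nonzero measure.\<close>
  have M0: "M \<ge> 0"
  proof (rule ccontr)
    assume "\<not> M \<ge> 0"
    then have "norm (g t) \<le> M \<longleftrightarrow> False" for t by (meson norm_ge_zero order_trans)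
    then have "AE t in (lebesgue :: real measure). False" using gM by simp
    then show False by (simp add: ae_filter_eq_bot_iff flip: trivial_limit_def)
  qed
  have bessel: "(\<Sum>n<K. (f (Suc n))\<^sup>2) \<le> M\<^sup>2" for K
  proof -
    have "(\<Sum>n<K. (f (Suc n))\<^sup>2) = (\<Sum>k=1..K. (f k)\<^sup>2)"
      by (simp add: sum.atLeast1_atMost_eq)
    also have "\<dots> \<le> M\<^sup>2"
      by (rule bessel_inequality_fourier_coeff[OF _ gM]) (use ess coeff in \<open>auto simp: essentially_bounded_def\<close>)
    finally show ?thesis .
  qed
  obtain \<mu> :: "real measure" where \<mu>: "sets \<mu> = sets borel"
    and mom: "\<And>k. k \<ge> 1 \<Longrightarrow> integrable \<mu> (\<lambda>t. t ^ (k - 1)) \<and> f k = (LINT t|\<mu>. t ^ (k - 1))"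
    using ham unfolding hamburger_solvable_def by blast
  have int: "integrable \<mu> (\<lambda>t. t ^ n)" and f: "f (Suc n) = (LINT t|\<mu>. t ^ n)" for n
    using mom[of "Suc n"] by auto
  have Q: "Q d f is = f (Suc (index_value d is))" for "is"
    by (simp add: Q_def index_value_def)
  have frob: "frobenius_norm d (\<lambda>is. Q d f is - F (index_value d is)) = sqrt (\<Sum>n<2 ^ d. (f (Suc n) - F n)\<^sup>2)"
    for F :: "nat \<Rightarrow> real"
    using sum_tensor_index[of "\<lambda>n. (f (Suc n) - F n)\<^sup>2" d] by (simp add: frobenius_norm_def Q)
  show "\<exists>T :: nat list \<Rightarrow> real.
           (\<forall>s\<in>{1..<d}. real (tt_rank d T s) \<le>
              (if M = 0 then 0
               else max 0 (20 * real d * (ln (real d) + ln (1 / \<epsilon>) + ln M + 1)))) \<and>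
           frobenius_norm d (\<lambda>is. Q d f is - T is) \<le> \<epsilon>"
  \<comment> \<open>The case of small \<open>M\<close> includes \<open>M = 0\<close> and all cases
    in which the logarithmic expression could be negative; rank 0 satisfies the bound in each of
    them.\<close>
  proof (cases "M \<le> \<epsilon>")
    case True
    have "tt_rank d (\<lambda>is. 0 :: real) s = 0" if "s \<in> {1..<d}" for s
      \<comment> \<open>The zero tensor is the exponential polynomial without nodes.\<close>
      using tt_rank_exponential_polynomial_le[of "{} :: nat set" s d undefined undefined 0] that by simp
    moreover have "frobenius_norm d (\<lambda>is. Q d f is - 0) \<le> sqrt (M\<^sup>2)"
      using frob[of "\<lambda>_. 0"] real_sqrt_le_mono[OF bessel[of "2 ^ d"]] by simp
    ultimately show ?thesis
      using True M0 by (intro exI[of _ "\<lambda>_. 0"]) auto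
  next
    case False
    \<comment> \<open>Its logarithm is the expression in the rank bound without the summand 1, and
      it is nonnegative because \<open>M > \<epsilon>\<close>.\<close>
    define x where "x = real d * M / \<epsilon>"
    have x1: "x \<ge> 1"
    proof -
      have "\<epsilon> * 1 \<le> M * real d" using False d \<epsilon> by (intro mult_mono) auto
      then show ?thesis using \<epsilon> by (simp add: x_def field_simps)
    qed
    have lnx: "ln x = ln (real d) + ln (1 / \<epsilon>) + ln M"
      using d \<epsilon> False by (simp add: x_def ln_mult ln_div)
    \<comment> \<open>The total error will be \<open>8 * (d + 1) * M / 2 ^ m\<close>, at most
      \<open>16 * d * M / 2 ^ m\<close>; this is the least \<open>m\<close> that brings the latter
      below \<open>\<epsilon>\<close>.\<close>
    define m where "m = nat \<lceil>log 2 (16 * x)\<rceil>"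
    have log0: "log 2 (16 * x) = 4 + log 2 x"
      using x1 log_pow_cancel[of 2 4] by (subst log_mult) auto
    have logx: "0 \<le> log 2 x" using x1 by simp
    have "16 * x \<le> 2 ^ m"
    proof -
      have "16 * x = 2 powr (log 2 (16 * x))" using x1 by simp
      also have "\<dots> \<le> 2 powr (real m)" unfolding m_def by (intro powr_mono real_nat_ceiling_ge) auto
      finally show ?thesis by (simp add: powr_realpow)
    qed
    then have m_ge: "16 * (real d * M) \<le> \<epsilon> * 2 ^ m" using \<epsilon> by (simp add: x_def field_simps)
    \<comment> \<open>The 5 is \<open>log 2 16\<close> plus 1 for rounding up.\<close>
    have "real m \<le> 5 + log 2 x"
      unfolding m_def log0 using logx by linarith
    also have "log 2 x \<le> 2 * ln x"
    proof -
      have "1 \<le> 2 * ln (2::real)" using ln2_ge_two_thirds by simp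
      then have "ln x * 1 \<le> ln x * (2 * ln 2)" using x1 by (intro mult_left_mono) auto
      then show ?thesis by (simp add: log_def field_simps)
    qed
    finally have m_le: "real m \<le> 5 * (ln x + 1)" using ln_ge_zero[OF x1] by simp
    obtain z :: "bool \<times> nat \<Rightarrow> real" and c where approx:
      "(\<Sum>n<2 ^ d. ((LINT t|\<mu>. t ^ n)
        - (\<Sum>(b, l)\<in>(UNIV \<times> {..d}) \<times> {..<m}. c b l * (real (n choose l) * z b ^ (n - l))))\<^sup>2)
        \<le> (2 * (real d + 1))\<^sup>2 * (16 * M\<^sup>2 / 4 ^ m)"
      using moments_exponential_polynomial_approx[OF \<mu> int bessel[unfolded f]] by blast
    define F where "F n = (\<Sum>(b, l)\<in>((UNIV :: bool set) \<times> {..d}) \<times> {..<m}. c b l * (real (n choose l) * z b ^ (n - l)))" for n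
    have "frobenius_norm d (\<lambda>is. Q d f is - F (index_value d is)) \<le> sqrt ((2 * (real d + 1))\<^sup>2 * (16 * M\<^sup>2 / 4 ^ m))"
      unfolding frob[of F] f unfolding F_def using approx by (rule real_sqrt_le_mono)
    also have "\<dots> = sqrt ((8 * (real d + 1) * M / 2 ^ m)\<^sup>2)"
    proof -
      have "((2::real) ^ m)\<^sup>2 = 4 ^ m" by (simp add: power2_eq_square flip: power_mult_distrib)
      then show ?thesis by (simp add: power_mult_distrib power_divide) (simp add: power2_eq_square algebra_simps)
    qed
    also have "\<dots> = 8 * (real d + 1) * M / 2 ^ m" using M0 by simp
    also have "\<dots> \<le> 16 * (real d * M) / 2 ^ m"
    proof (rule divide_right_mono)
      have "M * 1 \<le> M * real d" using M0 d by (intro mult_left_mono) auto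
      then show "8 * (real d + 1) * M \<le> 16 * (real d * M)" by (simp add: algebra_simps)
    qed simp
    also have "\<dots> \<le> \<epsilon>" using m_ge by (simp add: field_simps)
    finally have norm_le: "frobenius_norm d (\<lambda>is. Q d f is - F (index_value d is)) \<le> \<epsilon>" .
    \<comment> \<open>The constant 20 is 4 times 5: there are \<open>2 * (d + 1)\<close> blocks, at
      most \<open>4 * d\<close>, and \<open>m\<close> is at most
      \<open>5 * (ln x + 1)\<close>.\<close>
    have "real (tt_rank d (\<lambda>is. F (index_value d is)) s) \<le> 20 * real d * (ln x + 1)" if s: "s \<in> {1..<d}" for s
    proof -
      have "tt_rank d (\<lambda>is. F (index_value d is)) s \<le> card ((UNIV :: bool set) \<times> {..d}) * m"
        unfolding F_def using s by (intro tt_rank_exponential_polynomial_le[where 'a = real, simplified]) auto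
      then have "real (tt_rank d (\<lambda>is. F (index_value d is)) s) \<le> real (2 * (d + 1) * m)"
        by (simp only: of_nat_le_iff) simp
      also have "\<dots> = 2 * (real d + 1) * real m" by (simp add: algebra_simps)
      also have "\<dots> \<le> (4 * real d) * (5 * (ln x + 1))"
      proof (rule mult_mono[OF _ m_le])
        show "2 * (real d + 1) \<le> 4 * real d" using d by (simp add: distrib_left)
      qed auto
      finally show ?thesis by (simp add: algebra_simps)
    qed
    then show ?thesis
      using norm_le False \<epsilon> unfolding lnx
      by (intro exI[of _ "\<lambda>is. F (index_value d is)"]) (auto simp: le_max_iff_disj)
  qed
qed simp

end
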